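(* Let $u_1,u_2\in\mathbb{P}^*$. Then $u_1\sim_{ss}u_2$ if and only if the minimal clusters $m(u_1,E)$ and $m(u_2,E)$ are rearrangements of one another, for every embedding index set $E$ (for which these minimal clusters are defined).
   Context: $\mathbb{P}$ is the set of positive integers and $\mathbb{P}^*$ the set of finite words over $\mathbb{P}$. For $w=w_1\cdots w_n\in\mathbb{P}^*$, $|w|=n$ is its length and $\|w\|=w_1+\cdots+w_n$ its height. For words $u,w$, an index $j\ge 1$ is an embedding index of $u$ into $w$ if $j+|u|-1\le|w|$ and $u_i\le w_{j+i-1}$ for all $1\le i\le|u|$; $Em(u,w)$ denotes the set of all embedding indices of $u$ into $w$. A bijection $f:\mathbb{P}^*\to\mathbb{P}^*$ is weight-preserving if $|f(w)|=|w|$ and $\|f(w)\|=\|w\|$ for all $w$. Two words $u,v$ are super-strongly Wilf equivalent, written $u\sim_{ss}v$, if there is a weight-preserving bijection $f:\mathbb{P}^*\to\mathbb{P}^*$ with $Em(u,w)=Em(v,f(w))$ for all $w\in\mathbb{P}^*$. An embedding index set is a set $E=\{1,\,1+e_1,\,1+e_1+e_2,\ldots,1+e_1+\cdots+e_r\}$ with $r\ge 0$ and positive integers $e_1,\ldots,e_r$. For a word $u$ of length $n$ and an embedding index set $E$ with the additional (overlapping) property $1\le e_i\le n-1$ for all $i$, the pre-cluster $P(u,E)$ is the $(r+1)\times(e_1+\cdots+e_r+n)$ array whose $i$-th row contains a copy of $u$ shifted $e_1+\cdots+e_{i-1}$ places to the right, all remaining entries being $1$. The minimal cluster $m(u,E)$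 is the word of length $e_1+\cdots+e_r+n$ whose $j$-th letter is the maximum of the $j$-th column of $P(u,E)$. Two words are rearrangements of one another if each letter occurs the same number of times in both. *)

theory Defs
  imports Main "HOL-Library.Multiset"
begin

text \<open>Words over the positive integers are lists of naturals all of whose letters are positive.
  Lists are 0-based, so the \<open>i\<close>-th letter of \<open>u\<close> is \<open>u ! (i - 1)\<close>;
  embedding indices are kept 1-based.\<close>

definition words :: "nat list set" where
  "words = {w. \<forall>x\<in>set w. 1 \<le> x}"

definition Em :: "nat list \<Rightarrow> nat list \<Rightarrow> nat set" where
  "Em u w = {j. 1 \<le> j \<and> j + length u - 1 \<le> length w \<and>
                (\<forall>i<length u. u ! i \<le> w ! (j - 1 + i))}"

text \<open>The height of a word is \<open>sum_list\<close>.\<close>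

definition weight_preserving :: "(nat list \<Rightarrow> nat list) \<Rightarrow> bool" where
  "weight_preserving f \<longleftrightarrow>
     (\<forall>w\<in>words. length (f w) = length w \<and> sum_list (f w) = sum_list w)"

definition ss_wilf_equiv :: "nat list \<Rightarrow> nat list \<Rightarrow> bool"  (infix \<open>\<sim>\<^sub>s\<^sub>s\<close> 50) where
  "u \<sim>\<^sub>s\<^sub>s v \<longleftrightarrow>
     (\<exists>f. bij_betw f words words \<and> weight_preserving f \<and> (\<forall>w\<in>words. Em u w = Em v (f w)))"

text \<open>For \<open>es = [e\<^sub>1, \<dots>, e\<^sub>r]\<close> this is \<open>{1, 1 + e\<^sub>1, \<dots>, 1 + e\<^sub>1 + \<dots> + e\<^sub>r}\<close>.\<close>

definition index_set_of_gaps :: "nat list \<Rightarrow> nat set" where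
  "index_set_of_gaps es = {1 + sum_list (take i es) | i. i \<le> length es}"

definition embedding_index_set :: "nat set \<Rightarrow> bool" where
  "embedding_index_set E \<longleftrightarrow> (\<exists>es. (\<forall>e\<in>set es. 1 \<le> e) \<and> E = index_set_of_gaps es)"

text \<open>The overlapping property \<open>1 \<le> e\<^sub>i \<le> n - 1\<close> for words of length \<open>n\<close>. Since the gaps are
  positive, \<open>E\<close> determines \<open>es\<close>.\<close>

definition overlapping :: "nat \<Rightarrow> nat set \<Rightarrow> bool" where
  "overlapping n E \<longleftrightarrow> (\<exists>es. (\<forall>e\<in>set es. 1 \<le> e \<and> e < n) \<and> E = index_set_of_gaps es)"

text \<open>The array is given as its list of rows. If \<open>p = 1 + e\<^sub>1 + \<dots> + e\<^bsub>i-1\<^esub>\<close> is the \<open>i\<close>-th element of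
  \<open>E\<close>, the \<open>i\<close>-th row is shifted by \<open>p - 1\<close>, and \<open>Max E - p = e\<^sub>i + \<dots> + e\<^sub>r\<close> entries remain to the
  right of the copy of \<open>u\<close>.\<close>

definition pre_cluster :: "nat list \<Rightarrow> nat set \<Rightarrow> nat list list" where
  "pre_cluster u E =
     map (\<lambda>p. replicate (p - 1) 1 @ u @ replicate (Max E - p) 1) (sorted_list_of_set E)"

definition min_cluster :: "nat list \<Rightarrow> nat set \<Rightarrow> nat list" where
  "min_cluster u E =
     map (\<lambda>j. Max {row ! j | row. row \<in> set (pre_cluster u E)}) [0..<Max E - 1 + length u]"

definition rearrangement :: "nat list \<Rightarrow> nat list \<Rightarrow> bool" where
  "rearrangement v w \<longleftrightarrow> mset v = mset w"

end

theory Submission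
  imports Defs "HOL-Library.Groups_Big_Fun"
begin

text \<open>Both sides of the characterisation are compared with a third condition: the words have equal
length and, for every finite set \<open>E\<close> of shifts, overlapping or not, the columnwise maxima
of their copies shifted by \<open>E\<close>, with all letters lowered by one, have the same sum
(\<open>same_totals\<close>). After adding one for every column, this sum is the height of the
minimal word that contains the given word at the indices in \<open>E\<close>.

Equivalence and equal totals: the words in which \<open>u\<close> embeds at all indices in
\<open>E\<close> are those above one minimal word (\<open>subset_Em_iff\<close>). A bijection as required by
super-strong Wilf equivalence therefore forces the minimal words of \<open>u\<close> and \<open>v\<close>
to have the same height. Conversely, if these heights agree, exchanging one minimal word
for the other while keeping the surplus over it gives as many words with \<open>E\<close> inside the
embedding set for \<open>u\<close> as for \<open>v\<close>, at each length and height
(\<open>card_words_with_subset_Em\<close>). Moebius inversion over the sets \<open>E\<close> makes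
the numbers of words with embedding set exactly \<open>E\<close> agree, and matching these finite classes
yields the bijection.

Equal totals from rearranged clusters: rearranged clusters have the same height, and an
arbitrary set of shifts breaks at its large gaps into overlapping pieces that do not
interact (\<open>same_totals_if_overlapping_totals_eq\<close>).

Rearranged clusters from equal totals: this is the step where sums have to determine a
multiset. Fix \<open>E\<close> and let \<open>b\<close> be the cluster as a function on columns. A cover of
\<open>b\<close> by shifts in \<open>F\<close> is the cover of the original word by the sumset of
\<open>E\<close> and \<open>F\<close>, so the totals of the pointwise maxima of all families of shifts of
\<open>b\<close> are known. By inclusion-exclusion so are the totals of pointwise minima
(\<open>Sum_any_meet_cover_eq\<close>). Collecting the families of \<open>k\<close> shifts up to
translation, the sum of the minima of \<open>b\<close> over all \<open>k\<close>-element sets of columns is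
known for each \<open>k\<close> (\<open>sum_subset_minima_eq_meet_totals\<close>), and this family of
numbers determines the multiset of values of \<open>b\<close>
(\<open>image_mset_eq_if_subset_minima_eq\<close>).\<close>

section \<open>Recovering a multiset from minima over subsets\<close>

text \<open>A least element is the minimum of every subset to which it belongs.\<close>

lemma sum_subset_minima_remove:
  fixes b :: "'a \<Rightarrow> nat"
  assumes "finite A" and "a \<in> A" and least: "\<And>x. x \<in> A \<Longrightarrow> b a \<le> b x"
  shows "(\<Sum>S | S \<subseteq> A \<and> card S = Suc k. Min (b ` S)) =
    (\<Sum>S | S \<subseteq> A - {a} \<and> card S = Suc k. Min (b ` S)) + (card (A - {a}) choose k) * b a"
proof -
  let ?without = "{S. S \<subseteq> A - {a} \<and> card S = Suc k}"
  let ?with = "{S. S \<subseteq> A \<and> card S = Suc k \<and> a \<in> S}"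
  let ?rest = "{S. S \<subseteq> A - {a} \<and> card S = k}"
  have fin: "finite S" if "S \<subseteq> A" for S
    using that \<open>finite A\<close> finite_subset by blast
  have finP: "finite ?without" "finite ?with"
    using \<open>finite A\<close> by (auto intro: finite_subset[of _ "Pow A"])
  have split: "{S. S \<subseteq> A \<and> card S = Suc k} = ?without \<union> ?with"
    by auto
  have "?with = insert a ` ?rest"
  proof (intro equalityI subsetI)
    fix S assume S: "S \<in> ?with"
    then have "S = insert a (S - {a})" "S - {a} \<in> ?rest"
      using fin[of S] by auto
    then show "S \<in> insert a ` ?rest" by blast
  next
    fix S assume "S \<in> insert a ` ?rest"
    then obtain T where "T \<subseteq> A - {a}" "card T = k" "S = insert a T" by auto
    moreover from this have "a \<notin> T" "finite T" using fin[of T] by auto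
    ultimately show "S \<in> ?with"
      using \<open>a \<in> A\<close> by auto
  qed
  moreover have "inj_on (insert a) ?rest"
    by (rule inj_onI) blast
  ultimately have "card ?with = card (A - {a}) choose k"
    using \<open>finite A\<close> by (simp add: card_image n_subsets)
  moreover have "Min (b ` S) = b a" if "S \<in> ?with" for S
    using that least fin[of S] by (intro Min_eqI) auto
  ultimately have "(\<Sum>S\<in>?with. Min (b ` S)) = (card (A - {a}) choose k) * b a"
    by simp
  moreover have "(\<Sum>S | S \<subseteq> A \<and> card S = Suc k. Min (b ` S)) =
      (\<Sum>S\<in>?without. Min (b ` S)) + (\<Sum>S\<in>?with. Min (b ` S))"
    unfolding split using finP by (intro sum.union_disjoint) auto
  ultimately show ?thesis by simp
qed

text \<open>The only subset of full size is the whole set, so its minimum is the least value on each side. By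
the recurrence above, the contribution of that least value to all other sums is a known binomial
multiple, so it can be peeled off and the argument repeated on what remains.\<close>

lemma image_mset_eq_if_subset_minima_eq:
  fixes b :: "'a \<Rightarrow> nat" and c :: "'b \<Rightarrow> nat"
  assumes "finite A" and "finite B" and "card A = card B"
    and "\<And>k. (\<Sum>S | S \<subseteq> A \<and> card S = Suc k. Min (b ` S)) =
             (\<Sum>S | S \<subseteq> B \<and> card S = Suc k. Min (c ` S))"
  shows "image_mset b (mset_set A) = image_mset c (mset_set B)"
  using assms
proof (induction "card A" arbitrary: A B)
  case 0
  then show ?case by simp
next
  case (Suc n)
  have "A \<noteq> {}" "B \<noteq> {}" using Suc.hyps(2) Suc.prems(3) by auto
  define a where "a = arg_min_on b A"
  define a' where "a' = arg_min_on c B"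
  have a: "a \<in> A" "\<And>x. x \<in> A \<Longrightarrow> b a \<le> b x"
    unfolding a_def using Suc.prems \<open>A \<noteq> {}\<close>
    by (auto intro: arg_min_if_finite arg_min_least)
  have a': "a' \<in> B" "\<And>x. x \<in> B \<Longrightarrow> c a' \<le> c x"
    unfolding a'_def using Suc.prems \<open>B \<noteq> {}\<close>
    by (auto intro: arg_min_if_finite arg_min_least)
  have "S = A" if "S \<subseteq> A" "card S = Suc n" for S
    using that Suc.prems(1) Suc.hyps(2) by (intro card_subset_eq) auto
  moreover have "S = B" if "S \<subseteq> B" "card S = Suc n" for S
    using that Suc.prems(2,3) Suc.hyps(2) by (intro card_subset_eq) auto
  ultimately have "{S. S \<subseteq> A \<and> card S = Suc n} = {A}" "{S. S \<subseteq> B \<and> card S = Suc n} = {B}"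
    using Suc.hyps(2) Suc.prems(3) by auto
  then have "Min (b ` A) = Min (c ` B)"
    using Suc.prems(4)[of n] by simp
  moreover have "Min (b ` A) = b a"
    using a Suc.prems(1) by (intro Min_eqI) auto
  moreover have "Min (c ` B) = c a'"
    using a' Suc.prems(2) by (intro Min_eqI) auto
  ultimately have eq: "b a = c a'" by simp
  have cards: "card (A - {a}) = n" "card (B - {a'}) = n"
    using Suc.prems Suc.hyps(2) a(1) a'(1) by auto
  have "image_mset b (mset_set (A - {a})) = image_mset c (mset_set (B - {a'}))"
  proof (rule Suc.hyps(1))
    fix k
    show "(\<Sum>S | S \<subseteq> A - {a} \<and> card S = Suc k. Min (b ` S)) =
          (\<Sum>S | S \<subseteq> B - {a'} \<and> card S = Suc k. Min (c ` S))"
      using Suc.prems(4)[of k] sum_subset_minima_remove[of A a b k, OF Suc.prems(1) a]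
        sum_subset_minima_remove[of B a' c k, OF Suc.prems(2) a'] eq cards by simp
  qed (use Suc.prems cards in auto)
  moreover have "mset_set A = add_mset a (mset_set (A - {a}))"
    "mset_set B = add_mset a' (mset_set (B - {a'}))"
    using Suc.prems a(1) a'(1) by (simp_all add: mset_set.remove)
  ultimately show ?case using eq by simp
qed

section \<open>Covers by shifted copies and their totals\<close>

text \<open>A maximum of shifted copies, that is, a convolution over the max-plus semiring. The inserted
\<open>0\<close> is the default for empty \<open>E\<close>. Indexing by integers makes all
shifts invertible.\<close>

definition cover :: "(int \<Rightarrow> nat) \<Rightarrow> int set \<Rightarrow> int \<Rightarrow> nat" where
  "cover b E x = Max (insert 0 ((\<lambda>p. b (x - p)) ` E))"

definition finite_support :: "(int \<Rightarrow> nat) \<Rightarrow> bool" where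
  "finite_support b \<longleftrightarrow> finite {x. b x \<noteq> 0}"

text \<open>The invariant that links the two sides of the characterisation. Quantifying over all finite sets of
shifts, not only the overlapping ones, is what makes it stable under taking covers.\<close>

definition same_totals :: "(int \<Rightarrow> nat) \<Rightarrow> (int \<Rightarrow> nat) \<Rightarrow> bool" where
  "same_totals b c \<longleftrightarrow> (\<forall>E. finite E \<longrightarrow> Sum_any (cover b E) = Sum_any (cover c E))"

lemma cover_empty [simp]: "cover b {} x = 0"
  by (simp add: cover_def)

lemma cover_insert: "finite E \<Longrightarrow> cover b (insert p E) x = max (b (x - p)) (cover b E x)"
  by (simp add: cover_def insert_commute[of 0])

lemma cover_union:
  assumes "finite E" and "finite F"
  shows "cover b (E \<union> F) x = max (cover b E x) (cover b F x)"
  using assms(1) by induction (use assms(2) in \<open>auto simp: cover_insert\<close>)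

lemma cover_le_iff: "finite E \<Longrightarrow> cover b E x \<le> m \<longleftrightarrow> (\<forall>p\<in>E. b (x - p) \<le> m)"
  by (simp add: cover_def)

lemma cover_nonzero_iff: "finite E \<Longrightarrow> cover b E x \<noteq> 0 \<longleftrightarrow> (\<exists>p\<in>E. b (x - p) \<noteq> 0)"
  using cover_le_iff[of E b x 0] by auto

lemma cover_translate: "cover b ((+) t ` E) x = cover b E (x - t)"
  by (simp add: cover_def image_image algebra_simps)

text \<open>Covering twice is covering once by the sumset. This gives access to the totals of every cover
of \<open>cover b E\<close>, and so allows a single minimal cluster to be studied through all its
shifts.\<close>

lemma cover_cover:
  assumes "finite E" and "finite F"
  shows "cover (cover b E) F = cover b ((\<lambda>(p, f). p + f) ` (E \<times> F))"
proof
  fix x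
  have "cover (cover b E) F x \<le> m \<longleftrightarrow> cover b ((\<lambda>(p, f). p + f) ` (E \<times> F)) x \<le> m" for m
    using assms by (fastforce simp: cover_le_iff algebra_simps)
  then show "cover (cover b E) F x = cover b ((\<lambda>(p, f). p + f) ` (E \<times> F)) x"
    by (metis order_antisym order_refl)
qed

lemma finite_support_cover:
  assumes "finite_support b" and "finite E"
  shows "finite_support (cover b E)"
proof -
  have "{x. cover b E x \<noteq> 0} \<subseteq> (\<Union>p\<in>E. (+) p ` {x. b x \<noteq> 0})"
  proof
    fix x assume "x \<in> {x. cover b E x \<noteq> 0}"
    then obtain p where "p \<in> E" "b (x - p) \<noteq> 0"
      using cover_nonzero_iff[OF assms(2), of b x] by auto
    then show "x \<in> (\<Union>p\<in>E. (+) p ` {x. b x \<noteq> 0})"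
      by (intro UN_I[of p] image_eqI[of _ _ "x - p"]) auto
  qed
  then show ?thesis
    using assms unfolding finite_support_def by (auto intro: finite_subset)
qed

lemma same_totals_cover:
  assumes "same_totals b c" and "finite E"
  shows "same_totals (cover b E) (cover c E)"
  using assms by (simp add: same_totals_def cover_cover)

lemma Sum_any_translate: "Sum_any (\<lambda>x. b (x - t)) = Sum_any b" for t :: int
proof (rule sym, rule Sum_any.reindex_cong[where l = "\<lambda>x. x - t"])
  show "bij (\<lambda>x. x - t)"
    by (rule bij_betw_byWitness[of _ "\<lambda>x. x + t"]) auto
qed (simp add: fun_eq_iff)

lemma Sum_any_cover_translate: "Sum_any (cover b ((+) t ` E)) = Sum_any (cover b E)"
  using Sum_any_translate[of "cover b E" t] by (simp add: cover_translate)

lemma Sum_any_add: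
  "finite_support b \<Longrightarrow> finite_support c \<Longrightarrow> Sum_any (\<lambda>x. b x + c x) = Sum_any b + Sum_any c"
  unfolding finite_support_def by (rule Sum_any.distrib)

section \<open>Equal totals imply equal multisets of values\<close>

text \<open>Pointwise minimum of the copies of \<open>b\<close> shifted by \<open>F\<close>, capped by
\<open>cover b G\<close>. The cap serves two ends: it gives a meaning to the minimum for empty
\<open>F\<close>, and it is the parameter that an induction on \<open>F\<close> has to vary.\<close>

definition meet_cover :: "(int \<Rightarrow> nat) \<Rightarrow> int set \<Rightarrow> int set \<Rightarrow> int \<Rightarrow> nat" where
  "meet_cover b F G x = Min (insert (cover b G x) ((\<lambda>f. b (x - f)) ` F))"

lemma meet_cover_empty [simp]: "meet_cover b {} G = cover b G"
  by (simp add: meet_cover_def fun_eq_iff)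

lemma meet_cover_insert:
  "finite F \<Longrightarrow> meet_cover b (insert h F) G x = min (b (x - h)) (meet_cover b F G x)"
  by (simp add: meet_cover_def insert_commute[of "cover b G x"])

text \<open>Write \<open>m\<close> for the minimum over \<open>F\<close>, \<open>c\<close> for the cap and
\<open>d\<close> for the copy shifted by \<open>h\<close>. By distributivity
\<open>min m (max c d)\<close> is the maximum of \<open>min m c\<close> and \<open>min m d\<close>,
and the sum of two numbers is the sum of their maximum and their minimum.\<close>

lemma meet_cover_exchange:
  assumes "finite F" and "finite G"
  shows "meet_cover b (insert h F) G x + meet_cover b F (insert h G) x =
         meet_cover b F G x + meet_cover b F {h} x"
proof -
  have eq: "meet_cover b F G' x = (if F = {} then cover b G' x
      else min (cover b G' x) (Min ((\<lambda>f. b (x - f)) ` F)))" for G'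
    using assms(1) by (auto simp: meet_cover_def)
  show ?thesis
    using assms by (auto simp: meet_cover_insert eq cover_insert min_def max_def)
qed

lemma finite_support_meet_cover:
  assumes "finite_support b" and "finite F" and "finite G"
  shows "finite_support (meet_cover b F G)"
proof -
  have "meet_cover b F G x \<le> cover b G x" for x
    using assms(2) by (simp add: meet_cover_def)
  then have "{x. meet_cover b F G x \<noteq> 0} \<subseteq> {x. cover b G x \<noteq> 0}"
    by (smt (verit) Collect_mono le_zero_eq)
  then show ?thesis
    using finite_support_cover[OF assms(1,3)] unfolding finite_support_def
    by (rule finite_subset)
qed

text \<open>The exchange identity lowers the number of shifts under the minimum at the price of enlarging the
cap. This is inclusion-exclusion between minima and maxima in inductive form.\<close>

lemma Sum_any_meet_cover_eq:
  assumes "same_totals b c" and "finite_support b" and "finite_support c"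
    and "finite F" and "finite G"
  shows "Sum_any (meet_cover b F G) = Sum_any (meet_cover c F G)"
  using assms(4,5)
proof (induction F arbitrary: G)
  case empty
  then show ?case using assms(1) by (simp add: same_totals_def)
next
  case (insert h F)
  have exchange: "Sum_any (meet_cover d (insert h F) G) + Sum_any (meet_cover d F (insert h G)) =
      Sum_any (meet_cover d F G) + Sum_any (meet_cover d F {h})" if "finite_support d" for d
    using that insert.hyps insert.prems
    by (subst (1 2) Sum_any_add[symmetric])
      (simp_all add: meet_cover_exchange finite_support_meet_cover)
  show ?case
    using exchange[OF assms(2)] exchange[OF assms(3)] insert.IH[of G] insert.IH[of "{h}"]
      insert.IH[of "insert h G"] insert.prems by simp
qed

text \<open>Every nonempty finite set \<open>S\<close> of integers is \<open>x - F\<close> for exactly one pair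
of a point \<open>x\<close> and a set \<open>F\<close> of non-negative shifts containing
\<open>0\<close>, namely \<open>x = Max S\<close> and \<open>F = Max S - S\<close>. So summing minima over all
\<open>k\<close>-subsets is summing the totals of minima of shifted copies.\<close>

lemma sum_subset_minima_eq_meet_totals:
  assumes "finite A" and supp: "{x. b x \<noteq> 0} \<subseteq> A"
    and D: "\<And>x y. x \<in> A \<Longrightarrow> y \<in> A \<Longrightarrow> x - y \<le> D"
  shows "(\<Sum>S | S \<subseteq> A \<and> card S = Suc k. Min (b ` S)) =
    (\<Sum>F | F \<subseteq> {0..D} \<and> 0 \<in> F \<and> card F = Suc k. Sum_any (meet_cover b F {0}))"
proof -
  let ?F = "{F. F \<subseteq> {0..D} \<and> 0 \<in> F \<and> card F = Suc k}"
  let ?refl = "\<lambda>x F. (\<lambda>f. x - f) ` F"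
  have meet: "meet_cover b F {0} x = Min (b ` ?refl x F)" if "F \<in> ?F" for F x
  proof -
    have "insert (cover b {0} x) ((\<lambda>f. b (x - f)) ` F) = b ` ?refl x F"
      using that by (auto simp: cover_insert image_image intro: rev_image_eqI[of 0])
    then show ?thesis by (simp add: meet_cover_def)
  qed
  have finF: "finite F" if "F \<in> ?F" for F
    using that finite_subset by blast
  have vanish: "Min (b ` ?refl x F) = 0" if F: "F \<in> ?F" and outside: "\<not> ?refl x F \<subseteq> A" for F x
  proof -
    obtain f where f: "f \<in> F" "x - f \<notin> A" using outside by blast
    then have "b (x - f) = 0" using supp by blast
    then have "0 \<in> b ` ?refl x F" using f(1) by (force simp: image_iff)
    then have "Min (b ` ?refl x F) \<le> 0"
      using finF[OF F] by (intro Min_le) auto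
    then show ?thesis by simp
  qed
  have total: "Sum_any (meet_cover b F {0}) = (\<Sum>x\<in>A. Min (b ` ?refl x F))" if "F \<in> ?F" for F
  proof -
    have "Min (b ` ?refl x F) = 0" if "x \<notin> A" for x
    proof (rule vanish[OF \<open>F \<in> ?F\<close>])
      have "x - 0 \<in> ?refl x F" using \<open>F \<in> ?F\<close> by blast
      then show "\<not> ?refl x F \<subseteq> A" using that by auto
    qed
    then have "{x. Min (b ` ?refl x F) \<noteq> 0} \<subseteq> A"
      by (metis (mono_tags, lifting) mem_Collect_eq subsetI)
    then have "Sum_any (\<lambda>x. Min (b ` ?refl x F)) = (\<Sum>x\<in>A. Min (b ` ?refl x F))"
      by (rule Sum_any.expand_superset[OF assms(1)])
    moreover have "meet_cover b F {0} = (\<lambda>x. Min (b ` ?refl x F))"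
      using meet[OF \<open>F \<in> ?F\<close>] by (rule ext)
    ultimately show ?thesis by (simp only:)
  qed
  have finFs: "finite ?F"
    by (rule finite_subset[of _ "Pow {0..D}"]) auto
  let ?P = "{(F, x) \<in> ?F \<times> A. ?refl x F \<subseteq> A}"
  have "(\<Sum>F\<in>?F. Sum_any (meet_cover b F {0})) = (\<Sum>F\<in>?F. \<Sum>x\<in>A. Min (b ` ?refl x F))"
    using total by (intro sum.cong) auto
  also have "\<dots> = (\<Sum>(F, x)\<in>?F \<times> A. Min (b ` ?refl x F))"
    by (simp add: sum.cartesian_product)
  also have "\<dots> = (\<Sum>(F, x)\<in>?P. Min (b ` ?refl x F))"
  proof (rule sum.mono_neutral_right)
    show "\<forall>q\<in>?F \<times> A - ?P. (case q of (F, x) \<Rightarrow> Min (b ` ?refl x F)) = 0"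
      using vanish by (simp only: Ball_def Diff_iff mem_Sigma_iff mem_Collect_eq split_paired_All
          case_prod_conv) blast
  qed (use finFs assms(1) in auto)
  also have "\<dots> = (\<Sum>S | S \<subseteq> A \<and> card S = Suc k. Min (b ` S))"
  proof (rule sum.reindex_bij_witness[where i = "\<lambda>S. (?refl (Max S) S, Max S)"
        and j = "\<lambda>(F, x). ?refl x F"])
    fix q assume "q \<in> ?P"
    then obtain F x where q: "q = (F, x)" "F \<in> ?F" "x \<in> A" "?refl x F \<subseteq> A" by auto
    have "Max (?refl x F) = x"
      using q finF[OF q(2)] by (intro Max_eqI) (auto simp: image_iff)
    then show "(?refl (Max (case q of (F, x) \<Rightarrow> ?refl x F)) (case q of (F, x) \<Rightarrow> ?refl x F),
        Max (case q of (F, x) \<Rightarrow> ?refl x F)) = q"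
      by (simp add: q(1) image_image)
    have "card (?refl x F) = card F" by (intro card_image) (auto simp: inj_on_def)
    then show "(case q of (F, x) \<Rightarrow> ?refl x F) \<in> {S. S \<subseteq> A \<and> card S = Suc k}"
      using q by auto
  next
    fix S assume S: "S \<in> {S. S \<subseteq> A \<and> card S = Suc k}"
    then have finS: "finite S" "S \<noteq> {}" using assms(1) finite_subset by auto
    show "(case (?refl (Max S) S, Max S) of (F, x) \<Rightarrow> ?refl x F) = S"
      by (simp add: image_image)
    have MS: "Max S \<in> S" using finS by simp
    have "card (?refl (Max S) S) = card S" by (intro card_image) (auto simp: inj_on_def)
    moreover have "0 \<in> ?refl (Max S) S" using MS by (auto simp: image_iff)
    moreover have "?refl (Max S) S \<subseteq> {0..D}"
    proof
      fix f assume "f \<in> ?refl (Max S) S"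
      then obtain x where x: "x \<in> S" "f = Max S - x" by blast
      then have "f \<le> D" using D[of "Max S" x] S MS by blast
      then show "f \<in> {0..D}" using x finS(1) by simp
    qed
    ultimately show "(?refl (Max S) S, Max S) \<in> ?P"
      using S MS by (auto simp: image_image)
  qed auto
  finally show ?thesis by simp
qed

text \<open>Equal totals of covers pass to totals of minima of shifted copies, then to sums of minima over
subsets, and these determine the multiset of values.\<close>

lemma image_mset_eq_if_same_totals:
  assumes "same_totals b c" and "finite A" and "{x. b x \<noteq> 0} \<subseteq> A" and "{x. c x \<noteq> 0} \<subseteq> A"
  shows "image_mset b (mset_set A) = image_mset c (mset_set A)"
proof (rule image_mset_eq_if_subset_minima_eq)
  fix k
  let ?D = "Max A - Min A"
  have D: "x - y \<le> ?D" if "x \<in> A" "y \<in> A" for x y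
    using that assms(2) by (intro diff_mono) auto
  have supp: "finite_support b" "finite_support c"
    using assms unfolding finite_support_def by (auto intro: finite_subset)
  have "Sum_any (meet_cover b F {0}) = Sum_any (meet_cover c F {0})" if "F \<subseteq> {0..?D}" for F
    using that assms(1) supp by (intro Sum_any_meet_cover_eq) (auto intro: finite_subset)
  then show "(\<Sum>S | S \<subseteq> A \<and> card S = Suc k. Min (b ` S)) =
      (\<Sum>S | S \<subseteq> A \<and> card S = Suc k. Min (c ` S))"
    using sum_subset_minima_eq_meet_totals[of A b ?D k, OF assms(2,3) D]
      sum_subset_minima_eq_meet_totals[of A c ?D k, OF assms(2,4) D] by simp
qed (use assms in auto)

section \<open>Minimal words\<close>

text \<open>Subtracting one from every letter turns the filling letter \<open>1\<close> into
\<open>0\<close>, so a word becomes a finitely supported function on all of the integers, and columns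
that no copy reaches need no separate treatment.\<close>

definition excess :: "nat list \<Rightarrow> int \<Rightarrow> nat" where
  "excess u x = (if 0 \<le> x \<and> x < int (length u) then u ! nat x - 1 else 0)"

text \<open>If all copies fit, the least word of length \<open>N\<close> in which \<open>u\<close> embeds at
all indices in \<open>E\<close>. Where \<open>E\<close> has large gaps it consists of several minimal
clusters, with ones in the columns that no copy reaches. The successor in the column number translates list positions to the 1-based indices.\<close>

definition minimal_word :: "nat list \<Rightarrow> nat \<Rightarrow> nat set \<Rightarrow> nat list" where
  "minimal_word u N E = map (\<lambda>j. Suc (cover (excess u) (int ` E) (int (Suc j)))) [0..<N]"

definition fits :: "nat \<Rightarrow> nat \<Rightarrow> nat set \<Rightarrow> bool" where
  "fits n N E \<longleftrightarrow> (\<forall>p\<in>E. 1 \<le> p \<and> p + n - 1 \<le> N)"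

lemma length_minimal_word [simp]: "length (minimal_word u N E) = N"
  by (simp add: minimal_word_def)

lemma minimal_word_in_words: "minimal_word u N E \<in> words"
  by (auto simp: minimal_word_def words_def)

lemma nth_minimal_word:
  "j < N \<Longrightarrow> minimal_word u N E ! j = Suc (cover (excess u) (int ` E) (int (Suc j)))"
  by (simp add: minimal_word_def)

lemma finite_if_fits: "fits n N E \<Longrightarrow> finite E"
  by (rule finite_subset[of _ "{..N + 1}"]) (auto simp: fits_def)

lemma finite_support_excess: "finite_support (excess u)"
  unfolding finite_support_def
  by (rule finite_subset[of _ "{0..<int (length u)}"]) (auto simp: excess_def)

lemma excess_nonzeroD: "excess u x \<noteq> 0 \<Longrightarrow> 0 \<le> x \<and> x < int (length u)"
  by (auto simp: excess_def split: if_splits)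

text \<open>Embedding at all indices of \<open>E\<close> is a lower bound on each letter, so the words that
admit it form the up-set of the minimal word.\<close>

lemma subset_Em_iff:
  assumes "w \<in> words"
  shows "E \<subseteq> Em u w \<longleftrightarrow> fits (length u) (length w) E \<and>
    (\<forall>j<length w. minimal_word u (length w) E ! j \<le> w ! j)"
proof (cases "fits (length u) (length w) E")
  case True
  then have fin: "finite E" by (rule finite_if_fits)
  have pos: "1 \<le> w ! j" if "j < length w" for j
    using assms that by (simp add: words_def)
  have "E \<subseteq> Em u w \<longleftrightarrow> (\<forall>p\<in>E. \<forall>i<length u. u ! i \<le> w ! (p - 1 + i))"
    using True by (auto simp: Em_def fits_def)
  also have "\<dots> \<longleftrightarrow> (\<forall>j<length w. \<forall>p\<in>E. Suc (excess u (int (Suc j) - int p)) \<le> w ! j)"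
  proof (intro iffI allI impI ballI)
    fix j p
    assume *: "\<forall>p\<in>E. \<forall>i<length u. u ! i \<le> w ! (p - 1 + i)" and j: "j < length w" and p: "p \<in> E"
    show "Suc (excess u (int (Suc j) - int p)) \<le> w ! j"
    proof (cases "p \<le> Suc j \<and> Suc j - p < length u")
      case True
      define i where "i = Suc j - p"
      have i: "int (Suc j) - int p = int i" "p - 1 + i = j" "i < length u"
        using True p \<open>fits (length u) (length w) E\<close> by (auto simp: i_def fits_def)
      have "u ! i \<le> w ! j" using * p i by force
      then show ?thesis using pos[OF j] i by (simp add: excess_def)
    next
      case False
      then have "excess u (int (Suc j) - int p) = 0"
        using excess_nonzeroD[of u "int (Suc j) - int p"] by linarith
      then show ?thesis using pos[OF j] by simp
    qed
  next
    fix p i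
    assume *: "\<forall>j<length w. \<forall>p\<in>E. Suc (excess u (int (Suc j) - int p)) \<le> w ! j"
      and p: "p \<in> E" and i: "i < length u"
    have b: "1 \<le> p" "p + length u - 1 \<le> length w" using True p by (auto simp: fits_def)
    then have "p - 1 + i < length w" using i by linarith
    then have "Suc (excess u (int (Suc (p - 1 + i)) - int p)) \<le> w ! (p - 1 + i)" using * p by blast
    moreover have "int (Suc (p - 1 + i)) - int p = int i" using b by simp
    ultimately show "u ! i \<le> w ! (p - 1 + i)" using i by (simp add: excess_def)
  qed
  also have "\<dots> \<longleftrightarrow> (\<forall>j<length w. minimal_word u (length w) E ! j \<le> w ! j)"
  proof -
    have "(\<forall>p\<in>E. Suc (excess u (int (Suc j) - int p)) \<le> w ! j) \<longleftrightarrow>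
        minimal_word u (length w) E ! j \<le> w ! j" if "j < length w" for j
    proof -
      have "Suc m \<le> w ! j \<longleftrightarrow> m \<le> w ! j - 1" for m using pos[OF that] by linarith
      then show ?thesis
        using cover_le_iff[of "int ` E" "excess u" "int (Suc j)" "w ! j - 1"] fin that
        by (simp add: nth_minimal_word)
    qed
    then show ?thesis by blast
  qed
  finally show ?thesis using True by simp
next
  case False
  then show ?thesis by (auto simp: Em_def fits_def)
qed

text \<open>No part of the cover is cut off by the ends of a word into which all copies fit, which is why the
following height formula is exact.\<close>

lemma minimal_word_support:
  assumes "fits (length u) N E"
  shows "{x. cover (excess u) (int ` E) x \<noteq> 0} \<subseteq> (\<lambda>j. int (Suc j)) ` {0..<N}"
proof
  fix x assume "x \<in> {x. cover (excess u) (int ` E) x \<noteq> 0}"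
  then obtain p where p: "p \<in> E" "excess u (x - int p) \<noteq> 0"
    using cover_nonzero_iff[of "int ` E" "excess u" x] finite_if_fits[OF assms] by auto
  then have "0 \<le> x - int p" "x - int p < int (length u)"
    using excess_nonzeroD by blast+
  moreover have "1 \<le> p" "p + length u - 1 \<le> N" using assms p by (auto simp: fits_def)
  ultimately show "x \<in> (\<lambda>j. int (Suc j)) ` {0..<N}"
    by (intro image_eqI[of _ _ "nat (x - 1)"]) auto
qed

lemma sum_list_minimal_word:
  assumes "fits (length u) N E"
  shows "sum_list (minimal_word u N E) = N + Sum_any (cover (excess u) (int ` E))"
proof -
  have "sum_list (minimal_word u N E) =
      (\<Sum>j\<in>{0..<N}. Suc (cover (excess u) (int ` E) (int (Suc j))))"
    by (simp only: minimal_word_def interv_sum_list_conv_sum_set_nat set_upt)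
  also have "\<dots> = N + (\<Sum>j\<in>{0..<N}. cover (excess u) (int ` E) (int (Suc j)))"
    by (simp add: sum_Suc)
  also have "(\<Sum>j\<in>{0..<N}. cover (excess u) (int ` E) (int (Suc j))) =
      sum (cover (excess u) (int ` E)) ((\<lambda>j. int (Suc j)) ` {0..<N})"
    by (subst sum.reindex) (auto simp: inj_on_def)
  also have "\<dots> = Sum_any (cover (excess u) (int ` E))"
    using minimal_word_support[OF assms] by (intro Sum_any.expand_superset[symmetric]) auto
  finally show ?thesis .
qed

lemma mset_minimal_word:
  "mset (minimal_word u N E) =
    image_mset (Suc \<circ> cover (excess u) (int ` E)) (mset_set ((\<lambda>j. int (Suc j)) ` {0..<N}))"
proof -
  have "mset_set ((\<lambda>j. int (Suc j)) ` {0..<N}) = image_mset (\<lambda>j. int (Suc j)) (mset_set {0..<N})"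
    by (rule image_mset_mset_set[symmetric]) (auto simp: inj_on_def)
  then show ?thesis
    by (simp add: minimal_word_def multiset.map_comp comp_def)
qed

text \<open>Each row of the pre-cluster, fillers included, is one more than a shifted copy of the excess.\<close>

lemma min_cluster_eq_minimal_word:
  assumes "u \<in> words" and "finite E" and "E \<noteq> {}" and pos: "\<And>p. p \<in> E \<Longrightarrow> 1 \<le> p"
  shows "min_cluster u E = minimal_word u (Max E - 1 + length u) E"
proof (rule nth_equalityI)
  show "length (min_cluster u E) = length (minimal_word u (Max E - 1 + length u) E)"
    by (simp add: min_cluster_def)
next
  fix j assume "j < length (min_cluster u E)"
  then have j: "j < Max E - 1 + length u" by (simp add: min_cluster_def)
  define row where "row p = replicate (p - 1) 1 @ u @ replicate (Max E - p) 1" for p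
  have entry: "row p ! j = Suc (excess u (int (Suc j) - int p))" if p: "p \<in> E" for p
  proof -
    have "1 \<le> p" "p \<le> Max E" using p pos assms(2) by auto
    consider "j < p - 1" | "p - 1 \<le> j" "j < p - 1 + length u" | "p - 1 + length u \<le> j" by linarith
    then show ?thesis
    proof cases
      case 1
      then show ?thesis by (auto simp: row_def nth_append excess_def)
    next
      case 2
      then obtain i where i: "j = p - 1 + i" "i < length u"
        by (auto simp: le_iff_add)
      then have "int (Suc j) - int p = int i" using \<open>1 \<le> p\<close> by linarith
      moreover have "1 \<le> u ! i" using i assms(1) by (simp add: words_def)
      moreover have "row p ! j = u ! i" using i by (simp add: row_def nth_append)
      ultimately show ?thesis using i by (simp add: excess_def)
    next
      case 3
      then obtain k where "j = p - 1 + length u + k" by (auto simp: le_iff_add)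
      moreover from this have "k < Max E - p" using j \<open>1 \<le> p\<close> by linarith
      ultimately have "row p ! j = 1" by (simp add: row_def nth_append)
      moreover have "excess u (int (Suc j) - int p) = 0"
        using 3 \<open>1 \<le> p\<close> excess_nonzeroD[of u "int (Suc j) - int p"] by linarith
      ultimately show ?thesis by simp
    qed
  qed
  have "{r ! j | r. r \<in> set (pre_cluster u E)} = (\<lambda>p. row p ! j) ` E"
    using assms(2) by (auto simp: pre_cluster_def row_def)
  also have "\<dots> = Suc ` (\<lambda>p. excess u (int (Suc j) - p)) ` int ` E"
    using entry by (simp add: image_image)
  finally have "min_cluster u E ! j = Max (Suc ` (\<lambda>p. excess u (int (Suc j) - p)) ` int ` E)"
    using j by (simp add: min_cluster_def)
  also have "\<dots> = Suc (Max ((\<lambda>p. excess u (int (Suc j) - p)) ` int ` E))"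
    using assms(2,3) by (intro mono_Max_commute[symmetric]) (auto simp: mono_def)
  also have "Max ((\<lambda>p. excess u (int (Suc j) - p)) ` int ` E) = cover (excess u) (int ` E) (int (Suc j))"
    using assms(2,3) by (simp add: cover_def)
  finally show "min_cluster u E ! j = minimal_word u (Max E - 1 + length u) E ! j"
    using j by (simp add: nth_minimal_word)
qed

lemma fits_Max: "finite E \<Longrightarrow> (\<And>p. p \<in> E \<Longrightarrow> 1 \<le> p) \<Longrightarrow> fits n (Max E - 1 + n) E"
proof (unfold fits_def, intro ballI conjI)
  fix p assume "finite E" "\<And>p. p \<in> E \<Longrightarrow> 1 \<le> p" "p \<in> E"
  then have "1 \<le> p" "p \<le> Max E" by auto
  then show "1 \<le> p" "p + n - 1 \<le> Max E - 1 + n" by auto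
qed

section \<open>Splitting index sets at large gaps\<close>

lemma index_set_of_gaps_altdef: "index_set_of_gaps es = (\<lambda>i. 1 + sum_list (take i es)) ` {..length es}"
  by (auto simp: index_set_of_gaps_def)

lemma finite_index_set_of_gaps [simp]: "finite (index_set_of_gaps es)"
  by (simp add: index_set_of_gaps_altdef)

lemma index_set_of_gaps_nonempty [simp]: "index_set_of_gaps es \<noteq> {}"
  by (simp add: index_set_of_gaps_altdef)

lemma index_set_of_gaps_pos: "p \<in> index_set_of_gaps es \<Longrightarrow> 1 \<le> p"
  by (auto simp: index_set_of_gaps_def)

lemma index_set_of_gaps_Nil: "index_set_of_gaps [] = {1}"
  by (simp add: index_set_of_gaps_altdef)

lemma index_set_of_gaps_le: "p \<in> index_set_of_gaps es \<Longrightarrow> p \<le> 1 + sum_list es"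
proof -
  assume "p \<in> index_set_of_gaps es"
  then obtain i where "p = 1 + sum_list (take i es)" by (auto simp: index_set_of_gaps_def)
  moreover have "sum_list es = sum_list (take i es) + sum_list (drop i es)"
    by (metis append_take_drop_id sum_list_append)
  ultimately show ?thesis by simp
qed

lemma index_set_of_gaps_append:
  "index_set_of_gaps (es @ e # fs) =
    index_set_of_gaps es \<union> (+) (sum_list es + e) ` index_set_of_gaps fs"
proof -
  have "{..length (es @ e # fs)} = {..length es} \<union> (\<lambda>i. Suc (length es + i)) ` {..length fs}"
  proof (intro equalityI subsetI)
    fix i assume "i \<in> {..length (es @ e # fs)}"
    then show "i \<in> {..length es} \<union> (\<lambda>i. Suc (length es + i)) ` {..length fs}"
      by (cases "i \<le> length es") (auto intro!: image_eqI[of _ _ "i - Suc (length es)"])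
  qed auto
  then show ?thesis
    by (simp add: index_set_of_gaps_altdef image_Un image_image add.assoc)
qed

lemma Sum_any_cover_union:
  assumes "finite_support b" and "finite E" and "finite F"
    and "\<And>x. cover b E x = 0 \<or> cover b F x = 0"
  shows "Sum_any (cover b (E \<union> F)) = Sum_any (cover b E) + Sum_any (cover b F)"
proof -
  have "cover b (E \<union> F) x = cover b E x + cover b F x" for x
    using assms(4)[of x] assms(2,3) by (auto simp: cover_union)
  then have "cover b (E \<union> F) = (\<lambda>x. cover b E x + cover b F x)" ..
  then show ?thesis
    using assms by (simp add: Sum_any_add finite_support_cover)
qed

text \<open>Copies on the two sides of a gap of at least the length of the word share no column, and totals do
not change under translation.\<close>

lemma index_set_of_gaps_total_append:
  assumes "length u \<le> e"
  shows "Sum_any (cover (excess u) (int ` index_set_of_gaps (es @ e # fs))) =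
    Sum_any (cover (excess u) (int ` index_set_of_gaps es)) +
    Sum_any (cover (excess u) (int ` index_set_of_gaps fs))"
proof -
  let ?s = "int (sum_list es + e)"
  let ?E = "int ` index_set_of_gaps es" and ?F = "(+) ?s ` int ` index_set_of_gaps fs"
  have split: "int ` index_set_of_gaps (es @ e # fs) = ?E \<union> ?F"
    by (simp add: index_set_of_gaps_append image_Un image_image add.assoc)
  have "cover (excess u) ?E x = 0 \<or> cover (excess u) ?F x = 0" for x
  proof (rule ccontr)
    assume "\<not> ?thesis"
    then have "\<exists>p\<in>?E. excess u (x - p) \<noteq> 0" "\<exists>q\<in>?F. excess u (x - q) \<noteq> 0"
      by (subst cover_nonzero_iff[symmetric]; simp)+
    then obtain p q where p: "p \<in> index_set_of_gaps es" "excess u (x - int p) \<noteq> 0"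
      and q: "q \<in> index_set_of_gaps fs" "excess u (x - (?s + int q)) \<noteq> 0"
      by auto
    have "x - int p < int (length u)" "0 \<le> x - (?s + int q)"
      using p(2) q(2) excess_nonzeroD by blast+
    then show False
      using index_set_of_gaps_le[OF p(1)] index_set_of_gaps_pos[OF q(1)] assms by linarith
  qed
  then have "Sum_any (cover (excess u) (?E \<union> ?F)) =
      Sum_any (cover (excess u) ?E) + Sum_any (cover (excess u) ?F)"
    by (intro Sum_any_cover_union finite_support_excess) auto
  then show ?thesis by (simp only: split Sum_any_cover_translate)
qed

lemma gap_totals_eq:
  assumes "length u = length v"
    and overlapping: "\<And>es. (\<forall>e\<in>set es. 1 \<le> e \<and> e < length u) \<Longrightarrow>
      Sum_any (cover (excess u) (int ` index_set_of_gaps es)) =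
      Sum_any (cover (excess v) (int ` index_set_of_gaps es))"
    and "\<forall>e\<in>set es. 1 \<le> e"
  shows "Sum_any (cover (excess u) (int ` index_set_of_gaps es)) =
    Sum_any (cover (excess v) (int ` index_set_of_gaps es))"
  using assms(3)
proof (induction "length es" arbitrary: es rule: less_induct)
  case less
  show ?case
  proof (cases "\<exists>e\<in>set es. length u \<le> e")
    case True
    then obtain e xs ys where e: "length u \<le> e" and es: "es = xs @ e # ys"
      by (meson split_list)
    show ?thesis
      using less.hyps[of xs] less.hyps[of ys] less.prems e assms(1)
      unfolding es by (simp add: index_set_of_gaps_total_append)
  next
    case False
    then show ?thesis using less.prems by (intro overlapping) auto
  qed
qed

text \<open>By this normal form, statements about all finite sets of shifts reduce to lists of
gaps, which can be split.\<close>

lemma finite_int_set_as_gaps: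
  fixes E :: "int set"
  assumes "finite E" and "E \<noteq> {}"
  shows "\<exists>t es. (\<forall>e\<in>set es. 1 \<le> e) \<and> E = (+) t ` int ` index_set_of_gaps es"
  using assms
proof (induction E rule: finite_linorder_min_induct)
  case (insert m E)
  show ?case
  proof (cases "E = {}")
    case True
    then show ?thesis
      by (intro exI[of _ "m - 1"] exI[of _ "[]"]) (simp add: index_set_of_gaps_Nil)
  next
    case False
    then obtain t es where es: "\<forall>e\<in>set es. 1 \<le> e" and E: "E = (+) t ` int ` index_set_of_gaps es"
      using insert.IH by auto
    have "1 \<in> index_set_of_gaps es"
      by (auto simp: index_set_of_gaps_def intro!: exI[of _ 0])
    then have "t + 1 \<in> E" unfolding E by (auto simp: image_iff intro!: bexI[of _ 1])
    then have "m < t + 1" using insert.hyps by auto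
    define e where "e = nat (t + 1 - m)"
    have e: "1 \<le> e" "m - 1 + int e = t" using \<open>m < t + 1\<close> by (auto simp: e_def)
    have "index_set_of_gaps (e # es) = {1} \<union> (+) e ` index_set_of_gaps es"
      using index_set_of_gaps_append[of "[]" e es] by (simp add: index_set_of_gaps_Nil)
    then have "(+) (m - 1) ` int ` index_set_of_gaps (e # es) =
        insert m ((\<lambda>i. (m - 1 + int e) + int i) ` index_set_of_gaps es)"
      by (simp add: image_Un image_image add.assoc)
    then have "insert m E = (+) (m - 1) ` int ` index_set_of_gaps (e # es)"
      unfolding E e(2) by (simp add: image_image)
    then show ?thesis
      using es e(1) by (intro exI[of _ "m - 1"] exI[of _ "e # es"]) auto
  qed
qed simp

text \<open>An arbitrary finite set of shifts breaks at its large gaps into translates of overlapping sets, and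
its total is the sum of theirs.\<close>

lemma same_totals_if_overlapping_totals_eq:
  assumes "length u = length v"
    and "\<And>es. (\<forall>e\<in>set es. 1 \<le> e \<and> e < length u) \<Longrightarrow>
      Sum_any (cover (excess u) (int ` index_set_of_gaps es)) =
      Sum_any (cover (excess v) (int ` index_set_of_gaps es))"
  shows "same_totals (excess u) (excess v)"
  unfolding same_totals_def
proof (intro allI impI)
  fix E :: "int set" assume "finite E"
  show "Sum_any (cover (excess u) E) = Sum_any (cover (excess v) E)"
  proof (cases "E = {}")
    case False
    then obtain t es where "\<forall>e\<in>set es. 1 \<le> e" "E = (+) t ` int ` index_set_of_gaps es"
      using finite_int_set_as_gaps[OF \<open>finite E\<close>] by metis
    then show ?thesis
      using gap_totals_eq[OF assms, of es] by (simp add: Sum_any_cover_translate)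
  qed simp
qed

section \<open>Equivalent words have the same totals\<close>

lemma ss_wilf_equiv_sym:
  assumes "u \<sim>\<^sub>s\<^sub>s v"
  shows "v \<sim>\<^sub>s\<^sub>s u"
proof -
  obtain f where f: "bij_betw f words words" "weight_preserving f" "\<And>w. w \<in> words \<Longrightarrow> Em u w = Em v (f w)"
    using assms unfolding ss_wilf_equiv_def by blast
  let ?g = "the_inv_into words f"
  have g: "?g w \<in> words" "f (?g w) = w" if "w \<in> words" for w
    using f(1) that by (auto simp: bij_betw_def intro: the_inv_into_into f_the_inv_into_f)
  have "weight_preserving ?g"
    using f(2) g unfolding weight_preserving_def by metis
  moreover have "Em v w = Em u (?g w)" if "w \<in> words" for w
    using f(3) g that by metis
  ultimately show ?thesis
    using bij_betw_the_inv_into[OF f(1)] unfolding ss_wilf_equiv_def by blast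
qed

text \<open>A word embeds into itself, so \<open>v\<close> embeds into the image of \<open>u\<close>, a word of
the length of \<open>u\<close>.\<close>

lemma ss_wilf_equiv_length_le:
  assumes "u \<sim>\<^sub>s\<^sub>s v" and "u \<in> words"
  shows "length v \<le> length u"
proof -
  obtain f where f: "weight_preserving f" "Em u u = Em v (f u)"
    using assms unfolding ss_wilf_equiv_def by blast
  have "1 \<in> Em u u" by (simp add: Em_def)
  then have "1 \<in> Em v (f u)" using f(2) by simp
  then have "length v \<le> length (f u)" by (simp add: Em_def)
  then show ?thesis using f(1) assms(2) by (simp add: weight_preserving_def)
qed

text \<open>The image of the minimal word of \<open>u\<close> has the same height and contains \<open>v\<close>
at all indices in \<open>E\<close>, so it dominates the minimal word of \<open>v\<close>.\<close>

lemma ss_wilf_equiv_minimal_word_le: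
  assumes "u \<sim>\<^sub>s\<^sub>s v" and fits: "fits (length u) N E"
  shows "sum_list (minimal_word v N E) \<le> sum_list (minimal_word u N E)"
proof -
  obtain f where f: "bij_betw f words words" "weight_preserving f" "\<And>w. w \<in> words \<Longrightarrow> Em u w = Em v (f w)"
    using assms unfolding ss_wilf_equiv_def by blast
  let ?w = "minimal_word u N E"
  have w: "?w \<in> words" by (rule minimal_word_in_words)
  then have fw: "f ?w \<in> words" "length (f ?w) = N" "sum_list (f ?w) = sum_list ?w"
    using f(1,2) by (auto simp: bij_betw_def weight_preserving_def)
  have "E \<subseteq> Em u ?w"
    using fits by (subst subset_Em_iff[OF w]) simp
  then have "E \<subseteq> Em v (f ?w)" using f(3)[OF w] by simp
  then have "\<forall>j<N. minimal_word v N E ! j \<le> f ?w ! j"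
    using subset_Em_iff[OF fw(1)] fw(2) by simp
  then have "sum_list (minimal_word v N E) \<le> sum_list (f ?w)"
    using fw(2) by (intro sum_list_mono2) auto
  then show ?thesis using fw(3) by simp
qed

lemma same_totals_if_ss_wilf_equiv:
  assumes "u \<sim>\<^sub>s\<^sub>s v" and "length u = length v"
  shows "same_totals (excess u) (excess v)"
  unfolding same_totals_def
proof (intro allI impI)
  fix E :: "int set" assume "finite E"
  \<comment> \<open>Translate the shifts so that the least becomes the index 1.\<close>
  define t where "t = 1 - Min E"
  define E' where "E' = nat ` (+) t ` E"
  have pos: "1 \<le> t + p" if "p \<in> E" for p
    using that \<open>finite E\<close> by (simp add: t_def)
  then have E': "int ` E' = (+) t ` E"
    unfolding E'_def by (force simp: image_image)
  have "1 \<le> p" if "p \<in> E'" for p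
    using that pos unfolding E'_def by fastforce
  then have fits: "fits (length u) (Max E' - 1 + length u) E'"
    using \<open>finite E\<close> by (intro fits_Max) (simp_all add: E'_def)
  then have fits': "fits (length v) (Max E' - 1 + length u) E'"
    using assms(2) by simp
  have "sum_list (minimal_word u (Max E' - 1 + length u) E') =
      sum_list (minimal_word v (Max E' - 1 + length u) E')"
    using ss_wilf_equiv_minimal_word_le[OF assms(1) fits]
      ss_wilf_equiv_minimal_word_le[OF ss_wilf_equiv_sym[OF assms(1)] fits'] by simp
  then show "Sum_any (cover (excess u) E) = Sum_any (cover (excess v) E)"
    using sum_list_minimal_word[OF fits] sum_list_minimal_word[OF fits']
    by (simp add: E' Sum_any_cover_translate)
qed

section \<open>Words with the same totals are equivalent\<close>

text \<open>Uniqueness in Moebius inversion over a powerset, by downward induction.\<close>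

lemma eq_if_superset_sums_eq:
  fixes f g :: "'a set \<Rightarrow> nat"
  assumes "finite U"
    and sums: "\<And>E. E \<subseteq> U \<Longrightarrow> (\<Sum>F | E \<subseteq> F \<and> F \<subseteq> U. f F) = (\<Sum>F | E \<subseteq> F \<and> F \<subseteq> U. g F)"
    and "E \<subseteq> U"
  shows "f E = g E"
  using assms(3)
proof (induction "card (U - E)" arbitrary: E rule: less_induct)
  case less
  have fin: "finite {F. E \<subset> F \<and> F \<subseteq> U}"
    by (rule finite_subset[of _ "Pow U"]) (use assms(1) in auto)
  have split: "{F. E \<subseteq> F \<and> F \<subseteq> U} = insert E {F. E \<subset> F \<and> F \<subseteq> U}"
    using less.prems by auto
  have "f F = g F" if "E \<subset> F" "F \<subseteq> U" for F
  proof (rule less.hyps)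
    show "card (U - F) < card (U - E)"
      using that assms(1) by (intro psubset_card_mono) auto
  qed (fact that(2))
  then have "(\<Sum>F | E \<subset> F \<and> F \<subseteq> U. f F) = (\<Sum>F | E \<subset> F \<and> F \<subseteq> U. g F)"
    by (intro sum.cong) auto
  then show ?case
    using sums[OF less.prems] fin unfolding split by simp
qed

text \<open>Finite fibres of equal size can be matched one by one, and the matchings glue because the fibres
partition both sets.\<close>

lemma bij_betw_if_fibre_cards_eq:
  assumes fin: "\<And>k. finite {x \<in> A. f x = k}" "\<And>k. finite {y \<in> B. g y = k}"
    and cards: "\<And>k. card {x \<in> A. f x = k} = card {y \<in> B. g y = k}"
  shows "\<exists>h. bij_betw h A B \<and> (\<forall>x\<in>A. g (h x) = f x)"
proof -
  have "\<exists>h. bij_betw h {x \<in> A. f x = k} {y \<in> B. g y = k}" for k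
    by (rule finite_same_card_bij[OF fin cards])
  then obtain H where H: "\<And>k. bij_betw (H k) {x \<in> A. f x = k} {y \<in> B. g y = k}"
    by metis
  define h where "h x = H (f x) x" for x
  have h: "h x \<in> B" "g (h x) = f x" if "x \<in> A" for x
    using bij_betwE[OF H[of "f x"]] that by (auto simp: h_def)
  have "inj_on h A"
  proof (rule inj_onI)
    fix x y assume xy: "x \<in> A" "y \<in> A" "h x = h y"
    then have "f x = f y" using h(2) by metis
    then show "x = y"
      using xy bij_betw_imp_inj_on[OF H[of "f x"]] by (auto simp: h_def inj_on_def)
  qed
  moreover have "B \<subseteq> h ` A"
  proof
    fix y assume "y \<in> B"
    then have "y \<in> H (g y) ` {x \<in> A. f x = g y}"
      using bij_betw_imp_surj_on[OF H[of "g y"]] by blast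
    then obtain x where x: "x \<in> A" "f x = g y" "y = H (g y) x" by blast
    then have "y = h x" unfolding h_def by metis
    then show "y \<in> h ` A" using x(1) by (rule image_eqI)
  qed
  ultimately have "bij_betw h A B"
    using h(1) by (auto simp: bij_betw_def)
  then show ?thesis using h(2) by blast
qed

definition words_of_weight :: "nat \<Rightarrow> nat \<Rightarrow> nat list set" where
  "words_of_weight N s = {w \<in> words. length w = N \<and> sum_list w = s}"

lemma finite_words_of_weight: "finite (words_of_weight N s)"
proof (rule finite_subset)
  show "words_of_weight N s \<subseteq> {w. set w \<subseteq> {..s} \<and> length w = N}"
    using member_le_sum_list by (auto simp: words_of_weight_def)
  show "finite {w. set w \<subseteq> {..s} \<and> length w = N}"
    by (rule finite_lists_length_eq) simp
qed

text \<open>For a word above the minimal word of \<open>u\<close>, this keeps the surplus over it and puts the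
surplus on top of the minimal word of \<open>v\<close>.\<close>

definition replace_minimal_word :: "nat list \<Rightarrow> nat list \<Rightarrow> nat set \<Rightarrow> nat list \<Rightarrow> nat list" where
  "replace_minimal_word u v E w = map (\<lambda>j. w ! j - minimal_word u (length w) E ! j +
     minimal_word v (length w) E ! j) [0..<length w]"

lemma length_replace_minimal_word [simp]: "length (replace_minimal_word u v E w) = length w"
  by (simp add: replace_minimal_word_def)

text \<open>Height is preserved because equal totals mean that the two minimal words have equal height.\<close>

lemma replace_minimal_word:
  assumes "length u = length v" and "same_totals (excess u) (excess v)"
    and w: "w \<in> words_of_weight N s" and Em: "E \<subseteq> Em u w"
  shows "replace_minimal_word u v E w \<in> words_of_weight N s"
    and "E \<subseteq> Em v (replace_minimal_word u v E w)"
    and "replace_minimal_word v u E (replace_minimal_word u v E w) = w"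
proof -
  let ?r = "replace_minimal_word u v E w"
  have w': "w \<in> words" "length w = N" "sum_list w = s"
    using w by (auto simp: words_of_weight_def)
  have fits: "fits (length u) N E" and le: "\<And>j. j < N \<Longrightarrow> minimal_word u N E ! j \<le> w ! j"
    using Em subset_Em_iff[OF w'(1)] w'(2) by auto
  have nth: "?r ! j = w ! j - minimal_word u N E ! j + minimal_word v N E ! j" if "j < N" for j
    using that w'(2) by (simp add: replace_minimal_word_def)
  have pos: "1 \<le> minimal_word v N E ! j" if "j < N" for j
    using that by (simp add: nth_minimal_word)
  have len: "length ?r = N" using w'(2) by simp
  have "1 \<le> ?r ! j" if "j < N" for j
    unfolding nth[OF that] using pos[OF that] by (rule trans_le_add2)
  then have words: "?r \<in> words"
    using len unfolding words_def mem_Collect_eq in_set_conv_nth Ball_def by metis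
  have "sum_list (minimal_word u N E) = sum_list (minimal_word v N E)"
    using sum_list_minimal_word[of u N E] sum_list_minimal_word[of v N E] fits assms(1,2)
      finite_if_fits[OF fits] by (simp add: same_totals_def)
  then have mins: "(\<Sum>j<N. minimal_word u N E ! j) = (\<Sum>j<N. minimal_word v N E ! j)"
    by (simp add: sum_list_sum_nth atLeast0LessThan)
  have "(\<Sum>j<N. minimal_word u N E ! j) \<le> (\<Sum>j<N. w ! j)"
    using le by (intro sum_mono) auto
  moreover have "sum_list ?r =
      ((\<Sum>j<N. w ! j) - (\<Sum>j<N. minimal_word u N E ! j)) + (\<Sum>j<N. minimal_word v N E ! j)"
  proof -
    have "sum_list ?r = (\<Sum>j<N. ?r ! j)"
      by (simp only: sum_list_sum_nth len atLeast0LessThan)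
    also have "\<dots> = (\<Sum>j<N. w ! j - minimal_word u N E ! j + minimal_word v N E ! j)"
      by (rule sum.cong[OF refl], rule nth) simp
    also have "\<dots> = (\<Sum>j<N. w ! j - minimal_word u N E ! j) + (\<Sum>j<N. minimal_word v N E ! j)"
      by (rule sum.distrib)
    also have "(\<Sum>j<N. w ! j - minimal_word u N E ! j) =
        (\<Sum>j<N. w ! j) - (\<Sum>j<N. minimal_word u N E ! j)"
      by (rule sum_subtractf_nat) (simp add: le)
    finally show ?thesis .
  qed
  ultimately have "sum_list ?r = sum_list w"
    using mins w'(2) by (simp add: sum_list_sum_nth atLeast0LessThan)
  then show "?r \<in> words_of_weight N s"
    using words w' by (simp add: words_of_weight_def)
  show "E \<subseteq> Em v ?r"
    using subset_Em_iff[OF words] fits assms(1) w'(2) nth by simp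
  show "replace_minimal_word v u E ?r = w"
    using w'(2) nth le by (intro nth_equalityI) (simp_all add: replace_minimal_word_def)
qed

lemma card_words_with_subset_Em:
  assumes "length u = length v" and "same_totals (excess u) (excess v)"
  shows "card {w \<in> words_of_weight N s. E \<subseteq> Em u w} = card {w \<in> words_of_weight N s. E \<subseteq> Em v w}"
proof (rule bij_betw_same_card)
  have sym: "same_totals (excess v) (excess u)" using assms(2) by (simp add: same_totals_def)
  note there = replace_minimal_word[OF assms, where N = N and s = s]
  note onward = replace_minimal_word[OF assms(1)[symmetric] sym, where N = N and s = s]
  show "bij_betw (replace_minimal_word u v E)
      {w \<in> words_of_weight N s. E \<subseteq> Em u w} {w \<in> words_of_weight N s. E \<subseteq> Em v w}"
    by (rule bij_betw_byWitness[where f' = "replace_minimal_word v u E"])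
      (simp_all add: there onward image_subset_iff)
qed

text \<open>The counts of words whose embedding set contains a given set agree, and inversion over the finite
powerset of possible embedding sets turns them into counts of words with a given embedding set.\<close>

lemma card_words_with_Em_eq:
  assumes "length u = length v" and "same_totals (excess u) (excess v)"
  shows "card {w \<in> words_of_weight N s. Em u w = E} = card {w \<in> words_of_weight N s. Em v w = E}"
proof (cases "E \<subseteq> {1..N + 1}")
  case False
  have "Em x w \<subseteq> {1..N + 1}" if "w \<in> words_of_weight N s" for x w
    using that by (auto simp: Em_def words_of_weight_def)
  then have "{w \<in> words_of_weight N s. Em x w = E} = {}" for x
    using False by blast
  then show ?thesis by (simp only:)
next
  case True
  have Em: "Em x w \<subseteq> {1..N + 1}" if "w \<in> words_of_weight N s" for x w
    using that by (auto simp: Em_def words_of_weight_def)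
  have count: "card {w \<in> words_of_weight N s. F \<subseteq> Em x w} =
      (\<Sum>G | F \<subseteq> G \<and> G \<subseteq> {1..N + 1}. card {w \<in> words_of_weight N s. Em x w = G})" for x F
  proof -
    let ?S = "{w \<in> words_of_weight N s. F \<subseteq> Em x w}" and ?T = "{G. F \<subseteq> G \<and> G \<subseteq> {1..N + 1}}"
    have "finite ?S" using finite_words_of_weight by simp
    moreover have "finite ?T" by (rule finite_subset[of _ "Pow {1..N + 1}"]) auto
    moreover have "Em x ` ?S \<subseteq> ?T" using Em by blast
    ultimately have "(\<Sum>G\<in>?T. \<Sum>w | w \<in> ?S \<and> Em x w = G. (1::nat)) = (\<Sum>w\<in>?S. 1)"
      by (rule sum.group)
    moreover have "(\<Sum>w | w \<in> ?S \<and> Em x w = G. (1::nat)) = card {w \<in> words_of_weight N s. Em x w = G}"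
      if "G \<in> ?T" for G
    proof -
      have "{w. w \<in> ?S \<and> Em x w = G} = {w \<in> words_of_weight N s. Em x w = G}" using that by auto
      then show ?thesis by simp
    qed
    ultimately show ?thesis by simp
  qed
  show ?thesis
  proof (rule eq_if_superset_sums_eq[where U = "{1..N + 1}"])
    fix F
    show "(\<Sum>G | F \<subseteq> G \<and> G \<subseteq> {1..N + 1}. card {w \<in> words_of_weight N s. Em u w = G}) =
        (\<Sum>G | F \<subseteq> G \<and> G \<subseteq> {1..N + 1}. card {w \<in> words_of_weight N s. Em v w = G})"
      using card_words_with_subset_Em[OF assms, of N s F] by (simp only: count)
  qed (use True in auto)
qed

text \<open>A weight-preserving bijection compatible with the embedding sets is a bijection that respects
length, height and embedding set; such a one exists as soon as the numbers of words with given
values agree.\<close>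

lemma ss_wilf_equiv_if_same_totals:
  assumes "length u = length v" and "same_totals (excess u) (excess v)"
  shows "u \<sim>\<^sub>s\<^sub>s v"
proof -
  let ?key = "\<lambda>x w. (length w, sum_list w, Em x w)"
  have fibre: "{w \<in> words. ?key x w = k} =
      {w \<in> words_of_weight (fst k) (fst (snd k)). Em x w = snd (snd k)}" for x k
    by (auto simp: words_of_weight_def)
  have "\<exists>f. bij_betw f words words \<and> (\<forall>w\<in>words. ?key v (f w) = ?key u w)"
    by (rule bij_betw_if_fibre_cards_eq; unfold fibre)
      (use finite_words_of_weight card_words_with_Em_eq[OF assms] in auto)
  then show ?thesis
    unfolding ss_wilf_equiv_def weight_preserving_def by auto
qed

section \<open>Minimal clusters characterise super-strong Wilf equivalence\<close>

theorem theorem2: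
  fixes u1 u2 :: "nat list"
  assumes "u1 \<in> words" and "u2 \<in> words"
  shows "u1 \<sim>\<^sub>s\<^sub>s u2 \<longleftrightarrow>
    (\<forall>E. embedding_index_set E \<and> overlapping (length u1) E \<and> overlapping (length u2) E
         \<longrightarrow> rearrangement (min_cluster u1 E) (min_cluster u2 E))"
proof
  assume equiv: "u1 \<sim>\<^sub>s\<^sub>s u2"
  have len: "length u1 = length u2"
    using ss_wilf_equiv_length_le equiv ss_wilf_equiv_sym assms by (metis order_antisym)
  have totals: "same_totals (excess u1) (excess u2)"
    using equiv len by (rule same_totals_if_ss_wilf_equiv)
  show "\<forall>E. embedding_index_set E \<and> overlapping (length u1) E \<and> overlapping (length u2) E
         \<longrightarrow> rearrangement (min_cluster u1 E) (min_cluster u2 E)"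
  proof (intro allI impI)
    fix E assume "embedding_index_set E \<and> overlapping (length u1) E \<and> overlapping (length u2) E"
    then obtain es where "E = index_set_of_gaps es" by (auto simp: embedding_index_set_def)
    then have E: "finite E" "E \<noteq> {}" "\<And>p. p \<in> E \<Longrightarrow> 1 \<le> p"
      using index_set_of_gaps_pos by auto
    let ?N = "Max E - 1 + length u1"
    let ?J = "(\<lambda>j. int (Suc j)) ` {0..<?N}"
    let ?c1 = "cover (excess u1) (int ` E)" and ?c2 = "cover (excess u2) (int ` E)"
    have "fits (length u1) ?N E" "fits (length u2) ?N E"
      using fits_Max[OF E(1,3)] len by auto
    then have "image_mset ?c1 (mset_set ?J) = image_mset ?c2 (mset_set ?J)"
      using same_totals_cover[OF totals] E(1) minimal_word_support
      by (intro image_mset_eq_if_same_totals) auto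
    then have "mset (minimal_word u1 ?N E) = mset (minimal_word u2 ?N E)"
      by (simp only: mset_minimal_word multiset.map_comp[symmetric])
    then show "rearrangement (min_cluster u1 E) (min_cluster u2 E)"
      using min_cluster_eq_minimal_word[OF assms(1) E] min_cluster_eq_minimal_word[OF assms(2) E] len
      by (simp add: rearrangement_def)
  qed
next
  assume "\<forall>E. embedding_index_set E \<and> overlapping (length u1) E \<and> overlapping (length u2) E
         \<longrightarrow> rearrangement (min_cluster u1 E) (min_cluster u2 E)"
  then have clusters: "mset (min_cluster u1 (index_set_of_gaps es)) =
      mset (min_cluster u2 (index_set_of_gaps es))"
    if "\<forall>e\<in>set es. 1 \<le> e \<and> e < length u1 \<and> e < length u2" for es
    using that unfolding embedding_index_set_def overlapping_def rearrangement_def by blast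
  have cluster: "min_cluster u (index_set_of_gaps es) =
      minimal_word u (Max (index_set_of_gaps es) - 1 + length u) (index_set_of_gaps es)"
    if "u \<in> words" for u es
    using that index_set_of_gaps_pos by (intro min_cluster_eq_minimal_word) auto
  \<comment> \<open>The one-element index set overlaps for words of any length, and its cluster is the word itself.\<close>
  have "length (min_cluster u1 (index_set_of_gaps [])) = length (min_cluster u2 (index_set_of_gaps []))"
    using clusters[of "[]"] by (intro mset_eq_length) simp
  then have len: "length u1 = length u2"
    unfolding cluster[OF assms(1)] cluster[OF assms(2)] by (simp add: index_set_of_gaps_Nil)
  have "same_totals (excess u1) (excess u2)"
  proof (rule same_totals_if_overlapping_totals_eq[OF len])
    fix es assume es: "\<forall>e\<in>set es. 1 \<le> e \<and> e < length u1"
    let ?E = "index_set_of_gaps es"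
    let ?N = "Max ?E - 1 + length u1"
    have "fits n (Max ?E - 1 + n) ?E" for n
      by (rule fits_Max[OF finite_index_set_of_gaps index_set_of_gaps_pos])
    from this[of "length u1"] have fits: "fits (length u1) ?N ?E" "fits (length u2) ?N ?E"
      using len by (simp_all only:)
    have "mset (minimal_word u1 ?N ?E) = mset (minimal_word u2 ?N ?E)"
      using clusters[of es] es len assms by (simp add: cluster)
    then have "sum_list (minimal_word u1 ?N ?E) = sum_list (minimal_word u2 ?N ?E)"
      by (metis sum_mset_sum_list)
    then show "Sum_any (cover (excess u1) (int ` ?E)) = Sum_any (cover (excess u2) (int ` ?E))"
      using fits by (simp add: sum_list_minimal_word)
  qed
  with len show "u1 \<sim>\<^sub>s\<^sub>s u2" by (rule ss_wilf_equiv_if_same_totals)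
qed

end
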